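(* Let $F$ be a formula that is well-formed with respect to assignments $\Psi$ (of arity types to term variables) and $\Xi$ (of context variable types to context variables). Let $\theta$ be a closed substitution for all the variables assigned types by $\Psi$ such that $F[\theta]$ is defined, let $\Gamma$ be a context variable that possibly appears free in $F$, and let $\sigma$ be a closed substitution for all context variables other than $\Gamma$ that are assigned types by $\Xi$. Finally, let $G$ be a closed context expression such that $\vdash G\ \mathrm{ctx}$ is not derivable. Then (1) $F[\theta][\sigma][G/\Gamma]$ is valid if $\Gamma\vdash^+F$ is derivable; and (2) $F[\theta][\sigma][G/\Gamma]$ is not valid if $\Gamma\vdash^-F$ is derivable.
   Context: Canonical LF. Fix a well-formed LF signature $\Sigma$. Kinds, types and terms are $K ::= \mathrm{Type} \mid \Pi x{:}A.K$, $A,B ::= P \mid \Pi x{:}A.B$, $P ::= a \mid P\,M$, $M,N ::= R \mid \lambda x.M$, $R ::= c \mid x \mid R\,M$; only $\beta$-normal terms, well-typed ones $\eta$-long. Arity types are simple types over one base type $o$; erasure $P^-=o$, $(\Pi x{:}A_1.A_2)^-=A_1^-\to A_2^-$; $\Sigma^-=\{c{:}A^-\mid c{:}A\in\Sigma\}$. A substitution is a finite set $\theta=\{\langle x_i,M_i,\alpha_i\rangle\}$; $E[\theta]$ denotes its hereditary application, possibly undefined. Nominal constants and contexts. $\mathcal{N}$ is a set of nominal constants with arity types (infinitely many per arity type). Context expressions: $G ::= \Gamma\mid\cdot\mid G,n{:}A$. For closed expressions, $\vdash G\ \mathrm{ctx}$, $G\vdash A\ \mathrm{type}$, $G\vdash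 M\Leftarrow A$ are the canonical LF judgements with nominal constants in place of context-bound variables. Formulas of $\mathcal{L}_{LF}$: $F ::= \{G \vdash M : A\} \mid \top \mid \bot \mid F_1 \supset F_2 \mid F_1 \wedge F_2 \mid F_1 \vee F_2 \mid \forall x{:}\alpha.F \mid \exists x{:}\alpha.F \mid \Pi \Gamma{:}\mathcal{C}.F$ ($\mathcal{C}$ a context schema, i.e. a list of block schemas $\{x_1{:}\alpha_1,\ldots,x_n{:}\alpha_n\}y_1{:}A_1,\ldots,y_m{:}A_m$). $F$ is well-formed w.r.t. $\Psi,\Xi$ if its context variables are $\Pi$-bound or assigned by $\Xi$ and its terms/types are arity-well-formed w.r.t. $\Sigma^-$, $\mathcal{N}$, enclosing quantifiers and $\Psi$. $F[\theta]$, $F[\sigma]$, $F[G/\Gamma]$ are the (capture-avoiding) substitutions for term and context variables. The instances of $\mathcal{C}$ ($\mathcal{C}\leadsto G$) are concatenations of zero or more block-schema instances (each $y_j$ replaced by a distinct nominal constant of arity type $A_j^-$, each $x_i$ by a closed term $t_i$ with $\mathcal{N}\cup\Sigma^-\vdash t_i:\alpha_i$). Validity of closed formulas: $\{G\vdash M:A\}$ valid iff $\vdash G\ \mathrm{ctx}$, $G\vdash A\ \mathrm{type}$, $G\vdash M\Leftarrow A$ are derivable; $\top$ valid, $\bot$ not; $\supset,\wedge,\vee$ classical; $\Pi\Gamma{:}\mathcal{C}.F$ valid iff $F[G/\Gamma]$ valid for all $G$ with $\mathcal{C}\leadsto G$; $\forall x{:}\alpha.F$ (resp. $\exists$) valid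 iff $F[\{\langle x,M,\alpha\rangle\}]$ valid for all (resp. some) $M$ with $\mathcal{N}\cup\Sigma^-\vdash M:\alpha$. Ill-formedness analysis. $\Gamma\vdash^-F$ and $\Gamma\vdash^+F$ are the least relations with: $\Gamma\vdash^-\bot$; $\Gamma\vdash^-\{G\vdash M:A\}$ if $\Gamma$ appears in $G$; $\Gamma\vdash^-F_1\supset F_2$ if $\Gamma\vdash^+F_1$ and $\Gamma\vdash^-F_2$; $\Gamma\vdash^-F_1\vee F_2$ if $\Gamma\vdash^-F_1$ and $\Gamma\vdash^-F_2$; $\Gamma\vdash^-F_1\wedge F_2$ if $\Gamma\vdash^-F_i$ for some $i$; $\Gamma\vdash^+\top$; $\Gamma\vdash^+F_1\vee F_2$ if $\Gamma\vdash^+F_i$ for some $i$; $\Gamma\vdash^+F_1\wedge F_2$ if $\Gamma\vdash^+F_1$ and $\Gamma\vdash^+F_2$; $\Gamma\vdash^+F_1\supset F_2$ if $\Gamma\vdash^-F_1$ or $\Gamma\vdash^+F_2$; and for $\star\in\{+,-\}$: $\Gamma\vdash^\star\forall x{:}\alpha.F'$, $\Gamma\vdash^\star\exists x{:}\alpha.F'$, and (for $\Gamma'\ne\Gamma$) $\Gamma\vdash^\star\Pi\Gamma'{:}\mathcal{C}.F'$ whenever $\Gamma\vdash^\star F'$. *)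

theory Defs
  imports Main
begin

text \<open>
  Expressions are taken modulo renaming of bound variables by means of de Bruijn indices: term
  variables (bound by lambda, dependent products and the quantifiers of formulas) and context
  variables (bound by the context quantifier) are two separate index spaces. Indices pointing past
  all enclosing binders are the free variables. LF constants have names in \<open>'c\<close>, and \<open>'n\<close> is the
  type of nominal constants; a map \<open>N :: 'n \<Rightarrow> arity\<close> gives their arity types.
\<close>

section \<open>Syntax of canonical LF\<close>

datatype arity = Base | Arr arity arity

datatype ('c, 'n) trm = At "('c, 'n) atm" | Lam "('c, 'n) trm"
     and ('c, 'n) atm = Con 'c | Nom 'n | Var nat | App "('c, 'n) atm" "('c, 'n) trm"

datatype ('c, 'n) pty = TCon 'c | TApp "('c, 'n) pty" "('c, 'n) trm"

datatype ('c, 'n) ty = PTy "('c, 'n) pty" | TPi "('c, 'n) ty" "('c, 'n) ty"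

datatype ('c, 'n) kind = KType | KPi "('c, 'n) ty" "('c, 'n) kind"

datatype ('c, 'n) decl = CDecl 'c "('c, 'n) ty" | ADecl 'c "('c, 'n) kind"

text \<open>The most recent declaration is at the head of the list.\<close>

type_synonym ('c, 'n) sig = "('c, 'n) decl list"

primrec erase :: "('c, 'n) ty \<Rightarrow> arity" where
  "erase (PTy P) = Base"
| "erase (TPi A B) = Arr (erase A) (erase B)"

primrec erase_kind :: "('c, 'n) kind \<Rightarrow> arity list" where
  "erase_kind KType = []"
| "erase_kind (KPi A K) = erase A # erase_kind K"

text \<open>Contexts are those of the logic: they bind nominal constants, and may start with a context
  variable.\<close>

datatype ('c, 'n) ctx = CVar nat | CEmp | CSnoc "('c, 'n) ctx" 'n "('c, 'n) ty"

primrec bindings :: "('c, 'n) ctx \<Rightarrow> ('n \<times> ('c, 'n) ty) set" where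
  "bindings (CVar k) = {}"
| "bindings CEmp = {}"
| "bindings (CSnoc G n A) = insert (n, A) (bindings G)"

section \<open>Free variables\<close>

primrec fv_trm :: "('c, 'n) trm \<Rightarrow> nat set" and fv_atm :: "('c, 'n) atm \<Rightarrow> nat set" where
  "fv_trm (At R) = fv_atm R"
| "fv_trm (Lam M) = {i. Suc i \<in> fv_trm M}"
| "fv_atm (Con c) = {}"
| "fv_atm (Nom n) = {}"
| "fv_atm (Var i) = {i}"
| "fv_atm (App R M) = fv_atm R \<union> fv_trm M"

primrec fv_pty :: "('c, 'n) pty \<Rightarrow> nat set" where
  "fv_pty (TCon a) = {}"
| "fv_pty (TApp P M) = fv_pty P \<union> fv_trm M"

primrec fv_ty :: "('c, 'n) ty \<Rightarrow> nat set" where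
  "fv_ty (PTy P) = fv_pty P"
| "fv_ty (TPi A B) = fv_ty A \<union> {i. Suc i \<in> fv_ty B}"

primrec fv_ctx :: "('c, 'n) ctx \<Rightarrow> nat set" where
  "fv_ctx (CVar k) = {}"
| "fv_ctx CEmp = {}"
| "fv_ctx (CSnoc G n A) = fv_ctx G \<union> fv_ty A"

primrec cvars :: "('c, 'n) ctx \<Rightarrow> nat set" where
  "cvars (CVar k) = {k}"
| "cvars CEmp = {}"
| "cvars (CSnoc G n A) = cvars G"

definition closed_ctx :: "('c, 'n) ctx \<Rightarrow> bool" where
  "closed_ctx G \<longleftrightarrow> fv_ctx G = {} \<and> cvars G = {}"

section \<open>Renaming\<close>

text \<open>A renaming replaces variables by variables (\<open>Inl\<close>) or by nominal constants (\<open>Inr\<close>), in head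
  position and without eta-expansion.\<close>

definition up :: "(nat \<Rightarrow> nat + 'n) \<Rightarrow> nat \<Rightarrow> nat + 'n" where
  "up f i = (case i of 0 \<Rightarrow> Inl 0 | Suc j \<Rightarrow> map_sum Suc id (f j))"

primrec ren_trm :: "(nat \<Rightarrow> nat + 'n) \<Rightarrow> ('c, 'n) trm \<Rightarrow> ('c, 'n) trm"
    and ren_atm :: "(nat \<Rightarrow> nat + 'n) \<Rightarrow> ('c, 'n) atm \<Rightarrow> ('c, 'n) atm" where
  "ren_trm f (At R) = At (ren_atm f R)"
| "ren_trm f (Lam M) = Lam (ren_trm (up f) M)"
| "ren_atm f (Con c) = Con c"
| "ren_atm f (Nom n) = Nom n"
| "ren_atm f (Var i) = (case f i of Inl j \<Rightarrow> Var j | Inr n \<Rightarrow> Nom n)"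
| "ren_atm f (App R M) = App (ren_atm f R) (ren_trm f M)"

primrec ren_pty :: "(nat \<Rightarrow> nat + 'n) \<Rightarrow> ('c, 'n) pty \<Rightarrow> ('c, 'n) pty" where
  "ren_pty f (TCon a) = TCon a"
| "ren_pty f (TApp P M) = TApp (ren_pty f P) (ren_trm f M)"

primrec ren_ty :: "(nat \<Rightarrow> nat + 'n) \<Rightarrow> ('c, 'n) ty \<Rightarrow> ('c, 'n) ty" where
  "ren_ty f (PTy P) = PTy (ren_pty f P)"
| "ren_ty f (TPi A B) = TPi (ren_ty f A) (ren_ty (up f) B)"

primrec ren_kind :: "(nat \<Rightarrow> nat + 'n) \<Rightarrow> ('c, 'n) kind \<Rightarrow> ('c, 'n) kind" where
  "ren_kind f KType = KType"
| "ren_kind f (KPi A K) = KPi (ren_ty f A) (ren_kind (up f) K)"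

primrec ren_ctx :: "(nat \<Rightarrow> nat + 'n) \<Rightarrow> ('c, 'n) ctx \<Rightarrow> ('c, 'n) ctx" where
  "ren_ctx f (CVar k) = CVar k"
| "ren_ctx f CEmp = CEmp"
| "ren_ctx f (CSnoc G n A) = CSnoc (ren_ctx f G) n (ren_ty f A)"

abbreviation shift :: "nat \<Rightarrow> nat + 'n" where
  "shift \<equiv> (\<lambda>i. Inl (Suc i))"

text \<open>Inverse of \<open>shift\<close>; only used on expressions in which index \<open>0\<close> does not occur free.\<close>

abbreviation lower :: "nat \<Rightarrow> nat + 'n" where
  "lower \<equiv> (\<lambda>i. Inl (i - 1))"

section \<open>Hereditary substitution\<close>

text \<open>\<open>\<theta> x = Some (M, \<alpha>)\<close> stands for the presence of the triple of \<open>x\<close>, \<open>M\<close> and \<open>\<alpha>\<close> in the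
  substitution. Variables outside the domain are left alone. Application is a partial operation and
  is given as a relation: \<open>hs_trm \<theta> M M'\<close> means that the result of applying \<open>\<theta>\<close> to \<open>M\<close> is defined
  and is \<open>M'\<close>.\<close>

type_synonym ('c, 'n) sbst = "nat \<rightharpoonup> ('c, 'n) trm \<times> arity"

definition lift_sbst :: "('c, 'n) sbst \<Rightarrow> ('c, 'n) sbst" where
  "lift_sbst \<theta> i = (case i of 0 \<Rightarrow> None | Suc j \<Rightarrow> map_option (\<lambda>(M, \<alpha>). (ren_trm shift M, \<alpha>)) (\<theta> j))"

text \<open>On an atomic term the result is again atomic (\<open>hs_atm\<close>) unless the head variable is replaced,
  in which case it is a canonical term with an associated arity type (\<open>hs_red\<close>).\<close>

inductive hs_trm :: "('c, 'n) sbst \<Rightarrow> ('c, 'n) trm \<Rightarrow> ('c, 'n) trm \<Rightarrow> bool"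
      and hs_atm :: "('c, 'n) sbst \<Rightarrow> ('c, 'n) atm \<Rightarrow> ('c, 'n) atm \<Rightarrow> bool"
      and hs_red :: "('c, 'n) sbst \<Rightarrow> ('c, 'n) atm \<Rightarrow> ('c, 'n) trm \<Rightarrow> arity \<Rightarrow> bool" where
  hs_Lam: "hs_trm (lift_sbst \<theta>) M M' \<Longrightarrow> hs_trm \<theta> (Lam M) (Lam M')"
| hs_At_atm: "hs_atm \<theta> R R' \<Longrightarrow> hs_trm \<theta> (At R) (At R')"
| hs_At_red: "hs_red \<theta> R M \<alpha> \<Longrightarrow> hs_trm \<theta> (At R) M"
| hs_Con: "hs_atm \<theta> (Con c) (Con c)"
| hs_Nom: "hs_atm \<theta> (Nom n) (Nom n)"
| hs_Var: "\<theta> i = None \<Longrightarrow> hs_atm \<theta> (Var i) (Var i)"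
| hs_App: "\<lbrakk>hs_atm \<theta> R R'; hs_trm \<theta> M M'\<rbrakk> \<Longrightarrow> hs_atm \<theta> (App R M) (App R' M')"
| hs_red_Var: "\<theta> i = Some (M, \<alpha>) \<Longrightarrow> hs_red \<theta> (Var i) M \<alpha>"
| hs_red_App: "\<lbrakk>hs_red \<theta> R (Lam L) (Arr \<alpha> \<beta>); hs_trm \<theta> M M';
                hs_trm [0 \<mapsto> (ren_trm shift M', \<alpha>)] L L'\<rbrakk>
               \<Longrightarrow> hs_red \<theta> (App R M) (ren_trm lower L') \<beta>"

inductive hs_pty :: "('c, 'n) sbst \<Rightarrow> ('c, 'n) pty \<Rightarrow> ('c, 'n) pty \<Rightarrow> bool" where
  "hs_pty \<theta> (TCon a) (TCon a)"
| "\<lbrakk>hs_pty \<theta> P P'; hs_trm \<theta> M M'\<rbrakk> \<Longrightarrow> hs_pty \<theta> (TApp P M) (TApp P' M')"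

inductive hs_ty :: "('c, 'n) sbst \<Rightarrow> ('c, 'n) ty \<Rightarrow> ('c, 'n) ty \<Rightarrow> bool" where
  "hs_pty \<theta> P P' \<Longrightarrow> hs_ty \<theta> (PTy P) (PTy P')"
| "\<lbrakk>hs_ty \<theta> A A'; hs_ty (lift_sbst \<theta>) B B'\<rbrakk> \<Longrightarrow> hs_ty \<theta> (TPi A B) (TPi A' B')"

inductive hs_kind :: "('c, 'n) sbst \<Rightarrow> ('c, 'n) kind \<Rightarrow> ('c, 'n) kind \<Rightarrow> bool" where
  "hs_kind \<theta> KType KType"
| "\<lbrakk>hs_ty \<theta> A A'; hs_kind (lift_sbst \<theta>) K K'\<rbrakk> \<Longrightarrow> hs_kind \<theta> (KPi A K) (KPi A' K')"

inductive hs_ctx :: "('c, 'n) sbst \<Rightarrow> ('c, 'n) ctx \<Rightarrow> ('c, 'n) ctx \<Rightarrow> bool" where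
  "hs_ctx \<theta> (CVar k) (CVar k)"
| "hs_ctx \<theta> CEmp CEmp"
| "\<lbrakk>hs_ctx \<theta> G G'; hs_ty \<theta> A A'\<rbrakk> \<Longrightarrow> hs_ctx \<theta> (CSnoc G n A) (CSnoc G' n A')"

section \<open>Canonical LF judgements\<close>

text \<open>The LF context of a judgement consists of \<open>G\<close>, which binds nominal constants, followed by
  \<open>D\<close>, the types of the variables whose binders have been crossed, innermost first. For the
  judgements about closed expressions \<open>D\<close> is empty.\<close>

inductive lf_ty :: "('c, 'n) sig \<Rightarrow> ('c, 'n) ctx \<Rightarrow> ('c, 'n) ty list \<Rightarrow> ('c, 'n) ty \<Rightarrow> bool"
      and lf_pty :: "('c, 'n) sig \<Rightarrow> ('c, 'n) ctx \<Rightarrow> ('c, 'n) ty list \<Rightarrow> ('c, 'n) pty \<Rightarrow> ('c, 'n) kind \<Rightarrow> bool"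
      and lf_check :: "('c, 'n) sig \<Rightarrow> ('c, 'n) ctx \<Rightarrow> ('c, 'n) ty list \<Rightarrow> ('c, 'n) trm \<Rightarrow> ('c, 'n) ty \<Rightarrow> bool"
      and lf_synth :: "('c, 'n) sig \<Rightarrow> ('c, 'n) ctx \<Rightarrow> ('c, 'n) ty list \<Rightarrow> ('c, 'n) atm \<Rightarrow> ('c, 'n) ty \<Rightarrow> bool"
  for S :: "('c, 'n) sig" and G :: "('c, 'n) ctx" where
  lf_PTy: "lf_pty S G D P KType \<Longrightarrow> lf_ty S G D (PTy P)"
| lf_TPi: "\<lbrakk>lf_ty S G D A; lf_ty S G (A # D) B\<rbrakk> \<Longrightarrow> lf_ty S G D (TPi A B)"
| lf_TCon: "ADecl a K \<in> set S \<Longrightarrow> lf_pty S G D (TCon a) K"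
| lf_TApp: "\<lbrakk>lf_pty S G D P (KPi A K); lf_check S G D M A;
             hs_kind [0 \<mapsto> (ren_trm shift M, erase A)] K K'\<rbrakk>
            \<Longrightarrow> lf_pty S G D (TApp P M) (ren_kind lower K')"
| lf_At: "lf_synth S G D R (PTy P) \<Longrightarrow> lf_check S G D (At R) (PTy P)"
| lf_Lam: "lf_check S G (A # D) M B \<Longrightarrow> lf_check S G D (Lam M) (TPi A B)"
| lf_Con: "CDecl c A \<in> set S \<Longrightarrow> lf_synth S G D (Con c) A"
| lf_Nom: "(n, A) \<in> bindings G \<Longrightarrow> lf_synth S G D (Nom n) A"
| lf_Var: "i < length D \<Longrightarrow> lf_synth S G D (Var i) (ren_ty (\<lambda>j. Inl (j + Suc i)) (D ! i))"
| lf_App: "\<lbrakk>lf_synth S G D R (TPi A B); lf_check S G D M A;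
            hs_ty [0 \<mapsto> (ren_trm shift M, erase A)] B B'\<rbrakk>
           \<Longrightarrow> lf_synth S G D (App R M) (ren_ty lower B')"

inductive lf_kind :: "('c, 'n) sig \<Rightarrow> ('c, 'n) ctx \<Rightarrow> ('c, 'n) ty list \<Rightarrow> ('c, 'n) kind \<Rightarrow> bool"
  for S :: "('c, 'n) sig" and G :: "('c, 'n) ctx" where
  "lf_kind S G D KType"
| "\<lbrakk>lf_ty S G D A; lf_kind S G (A # D) K\<rbrakk> \<Longrightarrow> lf_kind S G D (KPi A K)"

inductive lf_ctx :: "('c, 'n) sig \<Rightarrow> ('c, 'n) ctx \<Rightarrow> bool" for S :: "('c, 'n) sig" where
  "lf_ctx S CEmp"
| "\<lbrakk>lf_ctx S G; lf_ty S G [] A; n \<notin> fst ` bindings G\<rbrakk> \<Longrightarrow> lf_ctx S (CSnoc G n A)"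

text \<open>Nominal constants cannot occur in a well-formed signature, since its types and kinds are
  checked in the empty context.\<close>

inductive wf_sig :: "('c, 'n) sig \<Rightarrow> bool" where
  "wf_sig []"
| "\<lbrakk>wf_sig S; lf_ty S CEmp [] A; \<forall>B. CDecl c B \<notin> set S\<rbrakk> \<Longrightarrow> wf_sig (CDecl c A # S)"
| "\<lbrakk>wf_sig S; lf_kind S CEmp [] K; \<forall>L. ADecl a L \<notin> set S\<rbrakk> \<Longrightarrow> wf_sig (ADecl a K # S)"

section \<open>Arity typing\<close>

definition ext :: "arity \<Rightarrow> (nat \<rightharpoonup> arity) \<Rightarrow> (nat \<rightharpoonup> arity)" where
  "ext \<alpha> \<Psi> i = (case i of 0 \<Rightarrow> Some \<alpha> | Suc j \<Rightarrow> \<Psi> j)"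

text \<open>Typing relative to the arity assignments given by \<open>N\<close>, the erasure of \<open>S\<close> and \<open>\<Psi>\<close>. Atomic
  terms count as canonical only at the base type, so well-typed terms are eta-long.\<close>

inductive ar_trm :: "('n \<Rightarrow> arity) \<Rightarrow> ('c, 'n) sig \<Rightarrow> (nat \<rightharpoonup> arity) \<Rightarrow> ('c, 'n) trm \<Rightarrow> arity \<Rightarrow> bool"
      and ar_atm :: "('n \<Rightarrow> arity) \<Rightarrow> ('c, 'n) sig \<Rightarrow> (nat \<rightharpoonup> arity) \<Rightarrow> ('c, 'n) atm \<Rightarrow> arity \<Rightarrow> bool"
  for N :: "'n \<Rightarrow> arity" and S :: "('c, 'n) sig" where
  ar_At: "ar_atm N S \<Psi> R Base \<Longrightarrow> ar_trm N S \<Psi> (At R) Base"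
| ar_Lam: "ar_trm N S (ext \<alpha> \<Psi>) M \<beta> \<Longrightarrow> ar_trm N S \<Psi> (Lam M) (Arr \<alpha> \<beta>)"
| ar_Con: "CDecl c A \<in> set S \<Longrightarrow> ar_atm N S \<Psi> (Con c) (erase A)"
| ar_Nom: "ar_atm N S \<Psi> (Nom n) (N n)"
| ar_Var: "\<Psi> i = Some \<alpha> \<Longrightarrow> ar_atm N S \<Psi> (Var i) \<alpha>"
| ar_App: "\<lbrakk>ar_atm N S \<Psi> R (Arr \<alpha> \<beta>); ar_trm N S \<Psi> M \<alpha>\<rbrakk> \<Longrightarrow> ar_atm N S \<Psi> (App R M) \<beta>"

inductive ar_pty :: "('n \<Rightarrow> arity) \<Rightarrow> ('c, 'n) sig \<Rightarrow> (nat \<rightharpoonup> arity) \<Rightarrow> ('c, 'n) pty \<Rightarrow> arity list \<Rightarrow> bool"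
  for N :: "'n \<Rightarrow> arity" and S :: "('c, 'n) sig" and \<Psi> :: "nat \<rightharpoonup> arity" where
  "ADecl a K \<in> set S \<Longrightarrow> ar_pty N S \<Psi> (TCon a) (erase_kind K)"
| "\<lbrakk>ar_pty N S \<Psi> P (\<alpha> # \<alpha>s); ar_trm N S \<Psi> M \<alpha>\<rbrakk> \<Longrightarrow> ar_pty N S \<Psi> (TApp P M) \<alpha>s"

inductive ar_ty :: "('n \<Rightarrow> arity) \<Rightarrow> ('c, 'n) sig \<Rightarrow> (nat \<rightharpoonup> arity) \<Rightarrow> ('c, 'n) ty \<Rightarrow> bool"
  for N :: "'n \<Rightarrow> arity" and S :: "('c, 'n) sig" where
  "ar_pty N S \<Psi> P [] \<Longrightarrow> ar_ty N S \<Psi> (PTy P)"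
| "\<lbrakk>ar_ty N S \<Psi> A; ar_ty N S (ext (erase A) \<Psi>) B\<rbrakk> \<Longrightarrow> ar_ty N S \<Psi> (TPi A B)"

section \<open>Context schemas\<close>

text \<open>The block schema with header \<open>x\<^sub>1:\<alpha>\<^sub>1, ..., x\<^sub>n:\<alpha>\<^sub>n\<close> and body \<open>y\<^sub>1:A\<^sub>1, ..., y\<^sub>m:A\<^sub>m\<close> is encoded
  as the pair \<open>([\<alpha>\<^sub>1, ..., \<alpha>\<^sub>n], [A\<^sub>1, ..., A\<^sub>m])\<close>, where in each of the types the free variables
  \<open>0, ..., n + m - 1\<close> stand for \<open>x\<^sub>1, ..., x\<^sub>n, y\<^sub>1, ..., y\<^sub>m\<close> in this order.\<close>

type_synonym ('c, 'n) block = "arity list \<times> ('c, 'n) ty list"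
type_synonym ('c, 'n) schema = "('c, 'n) block list"

definition assign :: "'b list \<Rightarrow> (nat \<rightharpoonup> 'b)" where
  "assign xs i = (if i < length xs then Some (xs ! i) else None)"

definition wf_block :: "('n \<Rightarrow> arity) \<Rightarrow> ('c, 'n) sig \<Rightarrow> ('c, 'n) block \<Rightarrow> bool" where
  "wf_block N S b \<longleftrightarrow> (case b of (\<alpha>s, As) \<Rightarrow>
     \<forall>j < length As. ar_ty N S (assign (\<alpha>s @ map erase (take j As))) (As ! j))"

definition wf_schema :: "('n \<Rightarrow> arity) \<Rightarrow> ('c, 'n) sig \<Rightarrow> ('c, 'n) schema \<Rightarrow> bool" where
  "wf_schema N S C \<longleftrightarrow> (\<forall>b \<in> set C. wf_block N S b)"

text \<open>The instance of a block determined by the terms \<open>ts\<close> for the header variables and the nominal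
  constants \<open>ns\<close> for the body variables.\<close>

inductive block_inst :: "('n \<Rightarrow> arity) \<Rightarrow> ('c, 'n) sig \<Rightarrow> ('c, 'n) block \<Rightarrow> ('n \<times> ('c, 'n) ty) list \<Rightarrow> bool"
  for N :: "'n \<Rightarrow> arity" and S :: "('c, 'n) sig" where
  "\<lbrakk>list_all2 (ar_trm N S Map.empty) ts \<alpha>s;
    distinct ns; map N ns = map erase As;
    list_all2
      (\<lambda>A A'. hs_ty (assign (zip ts \<alpha>s))
                (ren_ty (\<lambda>i. case assign (map Inl [0..<length \<alpha>s] @ map Inr ns) i of
                               Some h \<Rightarrow> h | None \<Rightarrow> Inl i) A) A') As As'\<rbrakk>
   \<Longrightarrow> block_inst N S (\<alpha>s, As) (zip ns As')"

inductive schema_inst :: "('n \<Rightarrow> arity) \<Rightarrow> ('c, 'n) sig \<Rightarrow> ('c, 'n) schema \<Rightarrow> ('c, 'n) ctx \<Rightarrow> bool"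
  for N :: "'n \<Rightarrow> arity" and S :: "('c, 'n) sig" and C :: "('c, 'n) schema" where
  "schema_inst N S C CEmp"
| "\<lbrakk>schema_inst N S C G; b \<in> set C; block_inst N S b bs\<rbrakk>
   \<Longrightarrow> schema_inst N S C (foldl (\<lambda>H (n, A). CSnoc H n A) G bs)"

section \<open>Formulas\<close>

datatype ('c, 'n) fm =
    FAtom "('c, 'n) ctx" "('c, 'n) trm" "('c, 'n) ty"
  | FTop
  | FBot
  | FImp "('c, 'n) fm" "('c, 'n) fm"
  | FAnd "('c, 'n) fm" "('c, 'n) fm"
  | FOr "('c, 'n) fm" "('c, 'n) fm"
  | FAll arity "('c, 'n) fm"
  | FEx arity "('c, 'n) fm"
  | FPi "('c, 'n) schema" "('c, 'n) fm"

text \<open>In \<open>wf_ctx\<close> and \<open>wf_fm\<close> the set \<open>X\<close> collects the context variables that are assigned a type.\<close>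

primrec wf_ctx :: "('n \<Rightarrow> arity) \<Rightarrow> ('c, 'n) sig \<Rightarrow> (nat \<rightharpoonup> arity) \<Rightarrow> nat set \<Rightarrow> ('c, 'n) ctx \<Rightarrow> bool" where
  "wf_ctx N S \<Psi> X (CVar k) \<longleftrightarrow> k \<in> X"
| "wf_ctx N S \<Psi> X CEmp \<longleftrightarrow> True"
| "wf_ctx N S \<Psi> X (CSnoc G n A) \<longleftrightarrow> wf_ctx N S \<Psi> X G \<and> ar_ty N S \<Psi> A \<and> N n = erase A"

primrec wf_fm :: "('n \<Rightarrow> arity) \<Rightarrow> ('c, 'n) sig \<Rightarrow> (nat \<rightharpoonup> arity) \<Rightarrow> nat set \<Rightarrow> ('c, 'n) fm \<Rightarrow> bool" where
  "wf_fm N S \<Psi> X (FAtom G M A) \<longleftrightarrow>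
     wf_ctx N S \<Psi> X G \<and> ar_ty N S \<Psi> A \<and> ar_trm N S \<Psi> M (erase A)"
| "wf_fm N S \<Psi> X FTop \<longleftrightarrow> True"
| "wf_fm N S \<Psi> X FBot \<longleftrightarrow> True"
| "wf_fm N S \<Psi> X (FImp F1 F2) \<longleftrightarrow> wf_fm N S \<Psi> X F1 \<and> wf_fm N S \<Psi> X F2"
| "wf_fm N S \<Psi> X (FAnd F1 F2) \<longleftrightarrow> wf_fm N S \<Psi> X F1 \<and> wf_fm N S \<Psi> X F2"
| "wf_fm N S \<Psi> X (FOr F1 F2) \<longleftrightarrow> wf_fm N S \<Psi> X F1 \<and> wf_fm N S \<Psi> X F2"
| "wf_fm N S \<Psi> X (FAll \<alpha> F) \<longleftrightarrow> wf_fm N S (ext \<alpha> \<Psi>) X F"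
| "wf_fm N S \<Psi> X (FEx \<alpha> F) \<longleftrightarrow> wf_fm N S (ext \<alpha> \<Psi>) X F"
| "wf_fm N S \<Psi> X (FPi C F) \<longleftrightarrow> wf_schema N S C \<and> wf_fm N S \<Psi> (insert 0 (Suc ` X)) F"

text \<open>Schemas have no free variables and are not affected by substitutions.\<close>

inductive hs_fm :: "('c, 'n) sbst \<Rightarrow> ('c, 'n) fm \<Rightarrow> ('c, 'n) fm \<Rightarrow> bool" where
  "\<lbrakk>hs_ctx \<theta> G G'; hs_trm \<theta> M M'; hs_ty \<theta> A A'\<rbrakk> \<Longrightarrow> hs_fm \<theta> (FAtom G M A) (FAtom G' M' A')"
| "hs_fm \<theta> FTop FTop"
| "hs_fm \<theta> FBot FBot"
| "\<lbrakk>hs_fm \<theta> F1 F1'; hs_fm \<theta> F2 F2'\<rbrakk> \<Longrightarrow> hs_fm \<theta> (FImp F1 F2) (FImp F1' F2')"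
| "\<lbrakk>hs_fm \<theta> F1 F1'; hs_fm \<theta> F2 F2'\<rbrakk> \<Longrightarrow> hs_fm \<theta> (FAnd F1 F2) (FAnd F1' F2')"
| "\<lbrakk>hs_fm \<theta> F1 F1'; hs_fm \<theta> F2 F2'\<rbrakk> \<Longrightarrow> hs_fm \<theta> (FOr F1 F2) (FOr F1' F2')"
| "hs_fm (lift_sbst \<theta>) F F' \<Longrightarrow> hs_fm \<theta> (FAll \<alpha> F) (FAll \<alpha> F')"
| "hs_fm (lift_sbst \<theta>) F F' \<Longrightarrow> hs_fm \<theta> (FEx \<alpha> F) (FEx \<alpha> F')"
| "hs_fm \<theta> F F' \<Longrightarrow> hs_fm \<theta> (FPi C F) (FPi C F')"

type_synonym ('c, 'n) csbst = "nat \<rightharpoonup> ('c, 'n) ctx"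

primrec cshift :: "('c, 'n) ctx \<Rightarrow> ('c, 'n) ctx" where
  "cshift (CVar k) = CVar (Suc k)"
| "cshift CEmp = CEmp"
| "cshift (CSnoc G n A) = CSnoc (cshift G) n A"

definition lift_csbst :: "('c, 'n) csbst \<Rightarrow> ('c, 'n) csbst" where
  "lift_csbst \<sigma> k = (case k of 0 \<Rightarrow> None | Suc j \<Rightarrow> map_option cshift (\<sigma> j))"

definition shift_csbst :: "('c, 'n) csbst \<Rightarrow> ('c, 'n) csbst" where
  "shift_csbst \<sigma> k = map_option (ren_ctx shift) (\<sigma> k)"

primrec cs_ctx :: "('c, 'n) csbst \<Rightarrow> ('c, 'n) ctx \<Rightarrow> ('c, 'n) ctx" where
  "cs_ctx \<sigma> (CVar k) = (case \<sigma> k of Some G \<Rightarrow> G | None \<Rightarrow> CVar k)"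
| "cs_ctx \<sigma> CEmp = CEmp"
| "cs_ctx \<sigma> (CSnoc G n A) = CSnoc (cs_ctx \<sigma> G) n A"

primrec cs_fm :: "('c, 'n) csbst \<Rightarrow> ('c, 'n) fm \<Rightarrow> ('c, 'n) fm" where
  "cs_fm \<sigma> (FAtom G M A) = FAtom (cs_ctx \<sigma> G) M A"
| "cs_fm \<sigma> FTop = FTop"
| "cs_fm \<sigma> FBot = FBot"
| "cs_fm \<sigma> (FImp F1 F2) = FImp (cs_fm \<sigma> F1) (cs_fm \<sigma> F2)"
| "cs_fm \<sigma> (FAnd F1 F2) = FAnd (cs_fm \<sigma> F1) (cs_fm \<sigma> F2)"
| "cs_fm \<sigma> (FOr F1 F2) = FOr (cs_fm \<sigma> F1) (cs_fm \<sigma> F2)"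
| "cs_fm \<sigma> (FAll \<alpha> F) = FAll \<alpha> (cs_fm (shift_csbst \<sigma>) F)"
| "cs_fm \<sigma> (FEx \<alpha> F) = FEx \<alpha> (cs_fm (shift_csbst \<sigma>) F)"
| "cs_fm \<sigma> (FPi C F) = FPi C (cs_fm (lift_csbst \<sigma>) F)"

text \<open>A closed substitution for the variables of \<open>\<Psi>\<close> replaces each of them by a term of the arity type
  that \<open>\<Psi>\<close> assigns to it. The typing of that term by \<open>N\<close> and the erasure of \<open>S\<close> alone entails that
  it has no free variables. A closed substitution for context variables is only required to yield
  contexts without free variables; these contexts need not be well-formed.\<close>

definition closed_sbst :: "('n \<Rightarrow> arity) \<Rightarrow> ('c, 'n) sig \<Rightarrow> (nat \<rightharpoonup> arity) \<Rightarrow> ('c, 'n) sbst \<Rightarrow> bool" where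
  "closed_sbst N S \<Psi> \<theta> \<longleftrightarrow> finite (dom \<theta>) \<and> dom \<theta> = dom \<Psi> \<and>
     (\<forall>x M \<alpha>. \<theta> x = Some (M, \<alpha>) \<longrightarrow> \<Psi> x = Some \<alpha> \<and> ar_trm N S Map.empty M \<alpha>)"

definition closed_csbst :: "nat set \<Rightarrow> ('c, 'n) csbst \<Rightarrow> bool" where
  "closed_csbst X \<sigma> \<longleftrightarrow> dom \<sigma> = X \<and> (\<forall>G \<in> ran \<sigma>. closed_ctx G)"

section \<open>Validity of closed formulas\<close>

primrec fm_height :: "('c, 'n) fm \<Rightarrow> nat" where
  "fm_height (FAtom G M A) = 0"
| "fm_height FTop = 0"
| "fm_height FBot = 0"
| "fm_height (FImp F1 F2) = Suc (max (fm_height F1) (fm_height F2))"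
| "fm_height (FAnd F1 F2) = Suc (max (fm_height F1) (fm_height F2))"
| "fm_height (FOr F1 F2) = Suc (max (fm_height F1) (fm_height F2))"
| "fm_height (FAll \<alpha> F) = Suc (fm_height F)"
| "fm_height (FEx \<alpha> F) = Suc (fm_height F)"
| "fm_height (FPi C F) = Suc (fm_height F)"

lemma fm_height_hs: "hs_fm \<theta> F F' \<Longrightarrow> fm_height F' = fm_height F"
  by (induction rule: hs_fm.induct) auto

lemma fm_height_cs: "fm_height (cs_fm \<sigma> F) = fm_height F"
  by (induction F arbitrary: \<sigma>) auto

text \<open>Since validity concerns closed formulas, the body of a quantifier has no free variable besides
  \<open>0\<close>, and no index has to be lowered when \<open>0\<close> is replaced by a closed expression.\<close>

context
  notes conj_cong [fundef_cong]
begin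

function valid :: "('n \<Rightarrow> arity) \<Rightarrow> ('c, 'n) sig \<Rightarrow> ('c, 'n) fm \<Rightarrow> bool" where
  "valid N S (FAtom G M A) \<longleftrightarrow> lf_ctx S G \<and> lf_ty S G [] A \<and> lf_check S G [] M A"
| "valid N S FTop \<longleftrightarrow> True"
| "valid N S FBot \<longleftrightarrow> False"
| "valid N S (FImp F1 F2) \<longleftrightarrow> (valid N S F1 \<longrightarrow> valid N S F2)"
| "valid N S (FAnd F1 F2) \<longleftrightarrow> valid N S F1 \<and> valid N S F2"
| "valid N S (FOr F1 F2) \<longleftrightarrow> valid N S F1 \<or> valid N S F2"
| "valid N S (FAll \<alpha> F) \<longleftrightarrow>
     (\<forall>M. ar_trm N S Map.empty M \<alpha> \<longrightarrow> (\<exists>F'. hs_fm [0 \<mapsto> (M, \<alpha>)] F F' \<and> valid N S F'))"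
| "valid N S (FEx \<alpha> F) \<longleftrightarrow>
     (\<exists>M. ar_trm N S Map.empty M \<alpha> \<and> (\<exists>F'. hs_fm [0 \<mapsto> (M, \<alpha>)] F F' \<and> valid N S F'))"
| "valid N S (FPi C F) \<longleftrightarrow> (\<forall>G. schema_inst N S C G \<longrightarrow> valid N S (cs_fm [0 \<mapsto> G] F))"
  by pat_completeness auto
termination
  by (relation "measure (\<lambda>(N, S, F). fm_height F)") (auto simp: fm_height_hs fm_height_cs)

end

section \<open>Ill-formedness analysis\<close>

text \<open>\<open>ill_neg g F\<close> and \<open>ill_pos g F\<close> are the negative and the positive relation between the context
  variable \<open>g\<close> and \<open>F\<close>. Below a context quantifier \<open>g\<close> becomes \<open>Suc g\<close>, which automatically differs
  from the bound variable \<open>0\<close>.\<close>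

inductive ill_neg :: "nat \<Rightarrow> ('c, 'n) fm \<Rightarrow> bool" and ill_pos :: "nat \<Rightarrow> ('c, 'n) fm \<Rightarrow> bool" where
  "ill_neg g FBot"
| "g \<in> cvars G \<Longrightarrow> ill_neg g (FAtom G M A)"
| "\<lbrakk>ill_pos g F1; ill_neg g F2\<rbrakk> \<Longrightarrow> ill_neg g (FImp F1 F2)"
| "\<lbrakk>ill_neg g F1; ill_neg g F2\<rbrakk> \<Longrightarrow> ill_neg g (FOr F1 F2)"
| "ill_neg g F1 \<Longrightarrow> ill_neg g (FAnd F1 F2)"
| "ill_neg g F2 \<Longrightarrow> ill_neg g (FAnd F1 F2)"
| "ill_neg g F \<Longrightarrow> ill_neg g (FAll \<alpha> F)"
| "ill_neg g F \<Longrightarrow> ill_neg g (FEx \<alpha> F)"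
| "ill_neg (Suc g) F \<Longrightarrow> ill_neg g (FPi C F)"
| "ill_pos g FTop"
| "ill_pos g F1 \<Longrightarrow> ill_pos g (FOr F1 F2)"
| "ill_pos g F2 \<Longrightarrow> ill_pos g (FOr F1 F2)"
| "\<lbrakk>ill_pos g F1; ill_pos g F2\<rbrakk> \<Longrightarrow> ill_pos g (FAnd F1 F2)"
| "ill_neg g F1 \<Longrightarrow> ill_pos g (FImp F1 F2)"
| "ill_pos g F2 \<Longrightarrow> ill_pos g (FImp F1 F2)"
| "ill_pos g F \<Longrightarrow> ill_pos g (FAll \<alpha> F)"
| "ill_pos g F \<Longrightarrow> ill_pos g (FEx \<alpha> F)"
| "ill_pos (Suc g) F \<Longrightarrow> ill_pos g (FPi C F)"

end

theory Submission
  imports Defs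
begin

text \<open>
  Since \<open>\<turnstile> G ctx\<close> fails, it fails for every extension of \<open>G\<close>, and likewise for every context that
  still contains a context variable. Both properties of a context survive all the substitutions
  that occur in the definition of validity, so the two analyses can be read on closed formulas,
  where they predict validity by induction on the height of the formula. Two points need care. A
  quantified formula is valid only if hereditary substitution into its body is defined; this holds
  because the body is arity-typed, by induction on the size of the arity types and then on the
  expression. A universal formula is refuted by an instance, which exists because every arity type
  is inhabited by a closed term. The contexts supplied by \<open>\<sigma>\<close> and the context \<open>G\<close> need not be
  arity-typed, but substitution acts as the identity on them.
\<close>

section \<open>Arity typing under renaming and hereditary substitution\<close>

inductive_cases ar_trm_AtE: "ar_trm N S \<Psi> (At R) \<alpha>"
inductive_cases ar_trm_LamE: "ar_trm N S \<Psi> (Lam M) \<alpha>"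
inductive_cases ar_trm_ArrE: "ar_trm N S \<Psi> M (Arr \<alpha> \<beta>)"
inductive_cases ar_atm_ConE: "ar_atm N S \<Psi> (Con c) \<alpha>"
inductive_cases ar_atm_NomE: "ar_atm N S \<Psi> (Nom n) \<alpha>"
inductive_cases ar_atm_VarE: "ar_atm N S \<Psi> (Var i) \<alpha>"
inductive_cases ar_atm_AppE: "ar_atm N S \<Psi> (App R M) \<alpha>"
inductive_cases ar_pty_TConE: "ar_pty N S \<Psi> (TCon a) \<alpha>s"
inductive_cases ar_pty_TAppE: "ar_pty N S \<Psi> (TApp P M) \<alpha>s"
inductive_cases ar_ty_PTyE: "ar_ty N S \<Psi> (PTy P)"
inductive_cases ar_ty_TPiE: "ar_ty N S \<Psi> (TPi A B)"

text \<open>Indices outside \<open>\<Psi>\<close> are unconstrained, so a renaming that makes sense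
  only on some indices can still be typed.\<close>

definition ren_typed :: "('n \<Rightarrow> arity) \<Rightarrow> (nat \<rightharpoonup> arity) \<Rightarrow> (nat \<Rightarrow> nat + 'n) \<Rightarrow> (nat \<rightharpoonup> arity) \<Rightarrow> bool" where
  "ren_typed N \<Psi> f \<Psi>' \<longleftrightarrow> (\<forall>i \<beta>. \<Psi> i = Some \<beta> \<longrightarrow>
     (case f i of Inl j \<Rightarrow> \<Psi>' j = Some \<beta> | Inr n \<Rightarrow> N n = \<beta>))"

text \<open>The arity stored with a substituted term is carried along by hereditary substitution, so
  it has to agree with the one in \<open>\<Psi>\<close>.\<close>

definition sbst_typed ::
  "('n \<Rightarrow> arity) \<Rightarrow> ('c, 'n) sig \<Rightarrow> (nat \<rightharpoonup> arity) \<Rightarrow> ('c, 'n) sbst \<Rightarrow> (nat \<rightharpoonup> arity) \<Rightarrow> bool" where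
  "sbst_typed N S \<Psi> \<theta> \<Psi>' \<longleftrightarrow> (\<forall>i \<beta>. \<Psi> i = Some \<beta> \<longrightarrow>
     (case \<theta> i of None \<Rightarrow> \<Psi>' i = Some \<beta> | Some (M, \<alpha>) \<Rightarrow> \<alpha> = \<beta> \<and> ar_trm N S \<Psi>' M \<beta>))"

lemma ren_typed_up: "ren_typed N \<Psi> f \<Psi>' \<Longrightarrow> ren_typed N (ext \<alpha> \<Psi>) (up f) (ext \<alpha> \<Psi>')"
  unfolding ren_typed_def ext_def up_def
  by (force split: nat.splits sum.splits simp: map_sum_def)

lemma ar_ren:
  shows "ar_trm N S \<Psi> M \<alpha> \<Longrightarrow> ren_typed N \<Psi> f \<Psi>' \<Longrightarrow> ar_trm N S \<Psi>' (ren_trm f M) \<alpha>"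
    and "ar_atm N S \<Psi> R \<alpha> \<Longrightarrow> ren_typed N \<Psi> f \<Psi>' \<Longrightarrow> ar_atm N S \<Psi>' (ren_atm f R) \<alpha>"
proof (induction arbitrary: f \<Psi>' and f \<Psi>' rule: ar_trm_ar_atm.inducts)
  case (ar_Var \<Psi> i \<alpha>)
  show ?case
  proof (cases "f i")
    case (Inl j)
    with ar_Var have "\<Psi>' j = Some \<alpha>" by (force simp: ren_typed_def)
    with Inl show ?thesis by (simp add: ar_trm_ar_atm.ar_Var)
  next
    case (Inr n)
    with ar_Var have "N n = \<alpha>" by (force simp: ren_typed_def)
    with Inr show ?thesis using ar_Nom by fastforce
  qed
next
  case (ar_App \<Psi> R \<alpha> \<beta> M)
  then show ?case by (metis ar_trm_ar_atm.ar_App ren_atm.simps(4))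
qed (auto intro: ar_trm_ar_atm.intros ren_typed_up)

lemma erase_ren [simp]: "erase (ren_ty f A) = erase A"
  by (induction A arbitrary: f) auto

lemma ar_pty_ren: "ar_pty N S \<Psi> P \<alpha>s \<Longrightarrow> ren_typed N \<Psi> f \<Psi>' \<Longrightarrow> ar_pty N S \<Psi>' (ren_pty f P) \<alpha>s"
  by (induction rule: ar_pty.induct) (auto intro: ar_pty.intros ar_ren)

lemma ar_ty_ren: "ar_ty N S \<Psi> A \<Longrightarrow> ren_typed N \<Psi> f \<Psi>' \<Longrightarrow> ar_ty N S \<Psi>' (ren_ty f A)"
proof (induction arbitrary: f \<Psi>' rule: ar_ty.induct)
  case (2 \<Psi> A B)
  then show ?case by (metis ar_ty.intros(2) erase_ren ren_ty.simps(2) ren_typed_up)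
qed (auto intro: ar_ty.intros ar_pty_ren)

lemma ren_typed_shift: "ren_typed N \<Psi> shift (ext \<alpha> \<Psi>)"
  by (simp add: ren_typed_def ext_def)

lemma sbst_typed_lift:
  "sbst_typed N S \<Psi> \<theta> \<Psi>' \<Longrightarrow> sbst_typed N S (ext \<alpha> \<Psi>) (lift_sbst \<theta>) (ext \<alpha> \<Psi>')"
  unfolding sbst_typed_def
proof (intro allI impI)
  fix i \<beta>
  assume *: "\<forall>i \<beta>. \<Psi> i = Some \<beta> \<longrightarrow>
     (case \<theta> i of None \<Rightarrow> \<Psi>' i = Some \<beta> | Some (M, \<alpha>) \<Rightarrow> \<alpha> = \<beta> \<and> ar_trm N S \<Psi>' M \<beta>)"
    and i: "ext \<alpha> \<Psi> i = Some \<beta>"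
  show "case lift_sbst \<theta> i of None \<Rightarrow> ext \<alpha> \<Psi>' i = Some \<beta>
        | Some (M, \<gamma>) \<Rightarrow> \<gamma> = \<beta> \<and> ar_trm N S (ext \<alpha> \<Psi>') M \<beta>"
  proof (cases i)
    case 0
    with i show ?thesis by (simp add: ext_def lift_sbst_def)
  next
    case (Suc j)
    with i have "\<Psi> j = Some \<beta>" by (simp add: ext_def)
    with * have "case \<theta> j of None \<Rightarrow> \<Psi>' j = Some \<beta> | Some (M, \<alpha>) \<Rightarrow> \<alpha> = \<beta> \<and> ar_trm N S \<Psi>' M \<beta>"
      by blast
    with Suc show ?thesis
      by (auto simp: ext_def lift_sbst_def split: option.splits intro: ar_ren ren_typed_shift)
  qed
qed

text \<open>Index \<open>0\<close> is left unassigned in the target, which makes \<open>lower\<close> type-correct without any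
  reasoning about free variables.\<close>

definition ext_none :: "(nat \<rightharpoonup> arity) \<Rightarrow> (nat \<rightharpoonup> arity)" where
  "ext_none \<Psi> i = (case i of 0 \<Rightarrow> None | Suc j \<Rightarrow> \<Psi> j)"

text \<open>The shifted \<open>M\<close> does not mention index \<open>0\<close>, so it is typed
  although the target leaves \<open>0\<close> unassigned. A contractum is thus typed without the
  bound variable, ready for \<open>lower\<close>.\<close>

lemma sbst_typed_beta:
  assumes "ar_trm N S \<Psi> M \<alpha>"
  shows "sbst_typed N S (ext \<alpha> \<Psi>) [0 \<mapsto> (ren_trm shift M, \<alpha>)] (ext_none \<Psi>)"
proof -
  have "ren_typed N \<Psi> shift (ext_none \<Psi>)"
    by (simp add: ren_typed_def ext_none_def)
  with assms have "ar_trm N S (ext_none \<Psi>) (ren_trm shift M) \<alpha>"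
    by (rule ar_ren)
  then show ?thesis
    by (auto simp: sbst_typed_def ext_def ext_none_def split: nat.splits)
qed

lemma ar_trm_lower: "ar_trm N S (ext_none \<Psi>) M \<alpha> \<Longrightarrow> ar_trm N S \<Psi> (ren_trm lower M) \<alpha>"
  by (erule ar_ren) (auto simp: ren_typed_def ext_none_def split: nat.splits)

text \<open>The contraction triggered by a replaced head is a premise of its rule, so an induction
  hypothesis covers it. That substitution uses the arity carried by \<open>hs_red\<close>, hence the
  third claim identifies it with the typed one.\<close>

lemma ar_hs:
  shows "hs_trm \<theta> M M' \<Longrightarrow> ar_trm N S \<Psi> M \<alpha> \<Longrightarrow> sbst_typed N S \<Psi> \<theta> \<Psi>' \<Longrightarrow> ar_trm N S \<Psi>' M' \<alpha>"
    and "hs_atm \<theta> R R' \<Longrightarrow> ar_atm N S \<Psi> R \<alpha> \<Longrightarrow> sbst_typed N S \<Psi> \<theta> \<Psi>' \<Longrightarrow> ar_atm N S \<Psi>' R' \<alpha>"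
    and "hs_red \<theta> R M \<beta> \<Longrightarrow> ar_atm N S \<Psi> R \<alpha> \<Longrightarrow> sbst_typed N S \<Psi> \<theta> \<Psi>' \<Longrightarrow>
           \<beta> = \<alpha> \<and> ar_trm N S \<Psi>' M \<alpha>"
proof (induction arbitrary: \<Psi> \<Psi>' \<alpha> and \<Psi> \<Psi>' \<alpha> and \<Psi> \<Psi>' \<alpha> rule: hs_trm_hs_atm_hs_red.inducts)
  case (hs_Lam \<theta> M M')
  then show ?case
    by (blast elim: ar_trm_LamE intro: ar_trm_ar_atm.intros sbst_typed_lift)
next
  case (hs_At_atm \<theta> R R')
  then show ?case by (blast elim: ar_trm_AtE intro: ar_trm_ar_atm.intros)
next
  case (hs_At_red \<theta> R M \<alpha>)
  then show ?case by (blast elim: ar_trm_AtE)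
next
  case (hs_Con \<theta> c)
  then show ?case by (blast elim: ar_atm_ConE intro: ar_trm_ar_atm.intros)
next
  case (hs_Nom \<theta> n)
  then show ?case by (blast elim: ar_atm_NomE intro: ar_trm_ar_atm.intros)
next
  case (hs_Var \<theta> i)
  then show ?case by (force elim: ar_atm_VarE intro: ar_trm_ar_atm.intros simp: sbst_typed_def)
next
  case (hs_App \<theta> R R' M M')
  then show ?case by (blast elim: ar_atm_AppE intro: ar_trm_ar_atm.intros)
next
  case (hs_red_Var \<theta> i M \<alpha>)
  then show ?case by (force elim: ar_atm_VarE simp: sbst_typed_def)
next
  case (hs_red_App \<theta> R L \<alpha>' \<beta> M M' L')
  from hs_red_App.prems(1) obtain \<gamma>
    where R: "ar_atm N S \<Psi> R (Arr \<gamma> \<alpha>)" and M: "ar_trm N S \<Psi> M \<gamma>"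
    by (rule ar_atm_AppE)
  from hs_red_App.IH(1)[OF R hs_red_App.prems(2)]
  have eq: "\<alpha>' = \<gamma>" "\<beta> = \<alpha>" and L: "ar_trm N S (ext \<gamma> \<Psi>') L \<alpha>"
    by (auto elim: ar_trm_LamE)
  have "ar_trm N S \<Psi>' M' \<gamma>"
    using hs_red_App.IH(2)[OF M hs_red_App.prems(2)] .
  then have "ar_trm N S (ext_none \<Psi>') L' \<alpha>"
    using hs_red_App.IH(3)[OF L] sbst_typed_beta eq by blast
  with eq show ?case by (blast intro: ar_trm_lower)
qed

lemma ar_pty_hs:
  "hs_pty \<theta> P P' \<Longrightarrow> ar_pty N S \<Psi> P \<alpha>s \<Longrightarrow> sbst_typed N S \<Psi> \<theta> \<Psi>' \<Longrightarrow> ar_pty N S \<Psi>' P' \<alpha>s"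
proof (induction arbitrary: \<alpha>s rule: hs_pty.induct)
  case (1 \<theta> a)
  then show ?case by (blast elim: ar_pty_TConE intro: ar_pty.intros)
next
  case (2 \<theta> P P' M M')
  then show ?case by (blast elim: ar_pty_TAppE intro: ar_pty.intros ar_hs)
qed

lemma erase_hs: "hs_ty \<theta> A A' \<Longrightarrow> erase A' = erase A"
  by (induction rule: hs_ty.induct) auto

lemma ar_ty_hs:
  "hs_ty \<theta> A A' \<Longrightarrow> ar_ty N S \<Psi> A \<Longrightarrow> sbst_typed N S \<Psi> \<theta> \<Psi>' \<Longrightarrow> ar_ty N S \<Psi>' A'"
proof (induction arbitrary: \<Psi> \<Psi>' rule: hs_ty.induct)
  case (1 \<theta> P P')
  then show ?case by (blast elim: ar_ty_PTyE intro: ar_ty.intros ar_pty_hs)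
next
  case (2 \<theta> A A' B B')
  then show ?case
    by (metis ar_ty_TPiE ar_ty.intros(2) erase_hs sbst_typed_lift)
qed

section \<open>Totality of hereditary substitution on arity-typed expressions\<close>

definition arity_bounded :: "nat \<Rightarrow> ('c, 'n) sbst \<Rightarrow> bool" where
  "arity_bounded k \<theta> \<longleftrightarrow> (\<forall>i M \<alpha>. \<theta> i = Some (M, \<alpha>) \<longrightarrow> size \<alpha> \<le> k)"

lemma arity_bounded_lift: "arity_bounded k \<theta> \<Longrightarrow> arity_bounded k (lift_sbst \<theta>)"
  by (fastforce simp: arity_bounded_def lift_sbst_def split: nat.splits)

text \<open>Outer induction on \<open>k\<close>, inner on the typing derivation. When the head of an
  application is replaced, its arity \<open>Arr \<alpha> \<beta>\<close> has size at most
  \<open>k\<close>, so the contraction substitutes at the smaller bound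
  \<open>size \<alpha>\<close>. The conjunct \<open>size \<gamma> \<le> k\<close> keeps this bound
  along the spine.\<close>

lemma hs_total_aux:
  fixes N :: "'n \<Rightarrow> arity" and S :: "('c, 'n) sig"
  shows "ar_trm N S \<Psi> M \<gamma> \<Longrightarrow> sbst_typed N S \<Psi> \<theta> \<Psi>' \<Longrightarrow> arity_bounded k \<theta> \<Longrightarrow> \<exists>M'. hs_trm \<theta> M M'"
    and "ar_atm N S \<Psi> R \<gamma> \<Longrightarrow> sbst_typed N S \<Psi> \<theta> \<Psi>' \<Longrightarrow> arity_bounded k \<theta> \<Longrightarrow>
           (\<exists>R'. hs_atm \<theta> R R') \<or> (\<exists>M'. hs_red \<theta> R M' \<gamma> \<and> size \<gamma> \<le> k)"
proof (induction k arbitrary: \<Psi> M R \<gamma> \<theta> \<Psi>' rule: less_induct)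
  case (less k)
  have "(ar_trm N S \<Psi> M \<gamma> \<longrightarrow> (\<forall>\<theta> \<Psi>'. sbst_typed N S \<Psi> \<theta> \<Psi>' \<longrightarrow> arity_bounded k \<theta> \<longrightarrow>
            (\<exists>M'. hs_trm \<theta> M M')))
      \<and> (ar_atm N S \<Psi> R \<gamma> \<longrightarrow> (\<forall>\<theta> \<Psi>'. sbst_typed N S \<Psi> \<theta> \<Psi>' \<longrightarrow> arity_bounded k \<theta> \<longrightarrow>
            (\<exists>R'. hs_atm \<theta> R R') \<or> (\<exists>M'. hs_red \<theta> R M' \<gamma> \<and> size \<gamma> \<le> k)))" for \<Psi> M R \<gamma>
  proof (induction rule: ar_trm_ar_atm.induct)
    case (ar_At \<Psi> R)
    then show ?case by (blast intro: hs_At_atm hs_At_red)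
  next
    case (ar_Lam \<alpha> \<Psi> M \<beta>)
    then show ?case by (blast intro: hs_Lam sbst_typed_lift arity_bounded_lift)
  next
    case (ar_Con c A \<Psi>)
    then show ?case by (blast intro: hs_Con)
  next
    case (ar_Nom \<Psi> n)
    then show ?case by (blast intro: hs_Nom)
  next
    case (ar_Var \<Psi> i \<alpha>)
    show ?case
    proof (intro allI impI)
      fix \<theta> :: "('c, 'n) sbst" and \<Psi>'
      assume *: "sbst_typed N S \<Psi> \<theta> \<Psi>'" "arity_bounded k \<theta>"
      show "(\<exists>R'. hs_atm \<theta> (Var i) R') \<or> (\<exists>M'. hs_red \<theta> (Var i) M' \<alpha> \<and> size \<alpha> \<le> k)"
      proof (cases "\<theta> i")
        case None
        then show ?thesis by (blast intro: hs_Var)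
      next
        case (Some p)
        then obtain M \<beta> where "\<theta> i = Some (M, \<beta>)" by (cases p) auto
        with * ar_Var have "\<theta> i = Some (M, \<alpha>)" "size \<alpha> \<le> k"
          by (force simp: sbst_typed_def arity_bounded_def)+
        then show ?thesis by (blast intro: hs_red_Var)
      qed
    qed
  next
    case (ar_App \<Psi> R \<alpha> \<beta> M)
    show ?case
    proof (intro allI impI)
      fix \<theta> :: "('c, 'n) sbst" and \<Psi>'
      assume *: "sbst_typed N S \<Psi> \<theta> \<Psi>'" "arity_bounded k \<theta>"
      with ar_App obtain M' where M': "hs_trm \<theta> M M'" by blast
      from ar_App * consider R' where "hs_atm \<theta> R R'"
        | K where "hs_red \<theta> R K (Arr \<alpha> \<beta>)" "size (Arr \<alpha> \<beta>) \<le> k" by blast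
      then show "(\<exists>R'. hs_atm \<theta> (App R M) R') \<or> (\<exists>M'. hs_red \<theta> (App R M) M' \<beta> \<and> size \<beta> \<le> k)"
      proof cases
        case 1
        with M' show ?thesis by (blast intro: hs_App)
      next
        case 2
        then have "ar_trm N S \<Psi>' K (Arr \<alpha> \<beta>)"
          using ar_hs(3) ar_App *(1) by blast
        \<comment> \<open>Typed terms are eta-long, so a term of arrow arity is an abstraction and
          the contraction is not stuck.\<close>
        then obtain L where K: "K = Lam L" and L: "ar_trm N S (ext \<alpha> \<Psi>') L \<beta>"
          by (rule ar_trm_ArrE)
        have "ar_trm N S \<Psi>' M' \<alpha>"
          using ar_hs(1) M' ar_App *(1) by blast
        then have "sbst_typed N S (ext \<alpha> \<Psi>') [0 \<mapsto> (ren_trm shift M', \<alpha>)] (ext_none \<Psi>')"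
          by (rule sbst_typed_beta)
        moreover have "arity_bounded (size \<alpha>) [0 \<mapsto> (ren_trm shift M', \<alpha>)]"
          by (simp add: arity_bounded_def)
        moreover have "size \<alpha> < k" using 2 by simp
        ultimately obtain L' where "hs_trm [0 \<mapsto> (ren_trm shift M', \<alpha>)] L L'"
          using less.IH(1) L by blast
        then have "hs_red \<theta> (App R M) (ren_trm lower L') \<beta>"
          using hs_red_App 2 K M' by blast
        with 2 show ?thesis by auto
      qed
    qed
  qed
  then show
    "ar_trm N S \<Psi> M \<gamma> \<Longrightarrow> sbst_typed N S \<Psi> \<theta> \<Psi>' \<Longrightarrow> arity_bounded k \<theta> \<Longrightarrow> \<exists>M'. hs_trm \<theta> M M'"
    "ar_atm N S \<Psi> R \<gamma> \<Longrightarrow> sbst_typed N S \<Psi> \<theta> \<Psi>' \<Longrightarrow> arity_bounded k \<theta> \<Longrightarrow>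
       (\<exists>R'. hs_atm \<theta> R R') \<or> (\<exists>M'. hs_red \<theta> R M' \<gamma> \<and> size \<gamma> \<le> k)"
    for \<Psi> M R \<gamma> \<theta> \<Psi>'
    by blast+
qed

lemma hs_trm_total:
  assumes "ar_trm N S \<Psi> M \<gamma>" "sbst_typed N S \<Psi> \<theta> \<Psi>'" "arity_bounded k \<theta>"
  obtains M' where "hs_trm \<theta> M M'"
  using hs_total_aux(1)[OF assms] by blast

lemma hs_pty_total:
  "ar_pty N S \<Psi> P \<alpha>s \<Longrightarrow> sbst_typed N S \<Psi> \<theta> \<Psi>' \<Longrightarrow> arity_bounded k \<theta> \<Longrightarrow> \<exists>P'. hs_pty \<theta> P P'"
proof (induction rule: ar_pty.induct)
  case (1 a K)
  then show ?case by (blast intro: hs_pty.intros)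
next
  case (2 P \<alpha> \<alpha>s M)
  then show ?case by (meson hs_trm_total hs_pty.intros(2))
qed

lemma hs_ty_total:
  "ar_ty N S \<Psi> A \<Longrightarrow> sbst_typed N S \<Psi> \<theta> \<Psi>' \<Longrightarrow> arity_bounded k \<theta> \<Longrightarrow> \<exists>A'. hs_ty \<theta> A A'"
proof (induction arbitrary: \<theta> \<Psi>' rule: ar_ty.induct)
  case (1 \<Psi> P)
  then show ?case by (meson hs_pty_total hs_ty.intros(1))
next
  case (2 \<Psi> A B)
  then show ?case by (meson hs_ty.intros(2) sbst_typed_lift arity_bounded_lift)
qed

text \<open>At \<open>Base\<close> a nominal constant is already eta-long; at an arrow arity,
  abstract over an inhabitant of the target, taken under one more variable.\<close>

lemma closed_term_exists:
  assumes "\<And>\<alpha>. infinite {n. N n = \<alpha>}"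
  shows "\<exists>M. ar_trm N S \<Psi> M \<alpha>"
proof (induction \<alpha> arbitrary: \<Psi>)
  case Base
  obtain n where "N n = Base"
    using assms[of Base] by (metis (mono_tags) empty_Collect_eq finite.emptyI)
  then show ?case by (metis ar_At ar_Nom)
next
  case (Arr \<alpha> \<beta>)
  then show ?case by (blast intro: ar_Lam)
qed

section \<open>Closed expressions\<close>

lemma up_fixes: "\<forall>i. Suc i \<in> V \<longrightarrow> f i = Inl i \<Longrightarrow> \<forall>i \<in> V. up f i = Inl i"
  by (auto simp: up_def split: nat.splits)

lemma ren_fixes:
  fixes M :: "('c, 'n) trm" and R :: "('c, 'n) atm"
  shows "\<forall>i \<in> fv_trm M. f i = Inl i \<Longrightarrow> ren_trm f M = M"
    and "\<forall>i \<in> fv_atm R. f i = Inl i \<Longrightarrow> ren_atm f R = R"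
  by (induction M and R arbitrary: f and f) (simp_all add: up_fixes ball_Un)

lemma ren_pty_fixes: "\<forall>i \<in> fv_pty P. f i = Inl i \<Longrightarrow> ren_pty f P = P"
  by (induction P) (auto simp: ren_fixes)

lemma ren_ty_fixes: "\<forall>i \<in> fv_ty A. f i = Inl i \<Longrightarrow> ren_ty f A = A"
proof (induction A arbitrary: f)
  case (TPi A B)
  then have "\<forall>i \<in> fv_ty B. up f i = Inl i" by (intro up_fixes) auto
  with TPi show ?case by simp
qed (simp add: ren_pty_fixes)

lemma ren_ctx_closed: "fv_ctx G = {} \<Longrightarrow> ren_ctx f G = G"
  by (induction G) (auto simp: ren_ty_fixes)

lemma cshift_closed: "cvars G = {} \<Longrightarrow> cshift G = G"
  by (induction G) auto

lemma cs_ctx_closed: "cvars G = {} \<Longrightarrow> cs_ctx \<sigma> G = G"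
  by (induction G) auto

lemma lift_sbst_None: "\<forall>i. Suc i \<in> V \<longrightarrow> \<theta> i = None \<Longrightarrow> \<forall>i \<in> V. lift_sbst \<theta> i = None"
  by (auto simp: lift_sbst_def split: nat.splits)

lemma hs_fixes:
  shows "\<forall>i \<in> fv_trm M. \<theta> i = None \<Longrightarrow> hs_trm \<theta> M M"
    and "\<forall>i \<in> fv_atm R. \<theta> i = None \<Longrightarrow> hs_atm \<theta> R R"
  by (induction M and R arbitrary: \<theta> and \<theta>)
    (simp_all add: hs_Lam hs_At_atm hs_Con hs_Nom hs_Var hs_App lift_sbst_None ball_Un)

lemma hs_pty_fixes: "\<forall>i \<in> fv_pty P. \<theta> i = None \<Longrightarrow> hs_pty \<theta> P P"
  by (induction P) (auto intro: hs_pty.intros hs_fixes)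

lemma hs_ty_fixes: "\<forall>i \<in> fv_ty A. \<theta> i = None \<Longrightarrow> hs_ty \<theta> A A"
proof (induction A arbitrary: \<theta>)
  case (TPi A B)
  then have "\<forall>i \<in> fv_ty B. lift_sbst \<theta> i = None" by (intro lift_sbst_None) auto
  with TPi show ?case by (simp add: hs_ty.intros)
qed (simp add: hs_ty.intros hs_pty_fixes)

text \<open>Application is a relation, so existence of the expected result does not exclude others.
  A derivation of \<open>hs_red\<close> starts from a head variable in the domain, which the third
  claim uses to exclude \<open>hs_At_red\<close>.\<close>

lemma hs_fixes_unique:
  shows "hs_trm \<theta> M M' \<Longrightarrow> \<forall>i \<in> fv_trm M. \<theta> i = None \<Longrightarrow> M' = M"
    and "hs_atm \<theta> R R' \<Longrightarrow> \<forall>i \<in> fv_atm R. \<theta> i = None \<Longrightarrow> R' = R"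
    and "hs_red \<theta> R L \<alpha> \<Longrightarrow> \<not> (\<forall>i \<in> fv_atm R. \<theta> i = None)"
  by (induction rule: hs_trm_hs_atm_hs_red.inducts) (simp_all add: lift_sbst_None ball_Un)

lemma hs_pty_fixes_unique: "hs_pty \<theta> P P' \<Longrightarrow> \<forall>i \<in> fv_pty P. \<theta> i = None \<Longrightarrow> P' = P"
  by (induction rule: hs_pty.induct) (auto dest: hs_fixes_unique)

lemma hs_ty_fixes_unique: "hs_ty \<theta> A A' \<Longrightarrow> \<forall>i \<in> fv_ty A. \<theta> i = None \<Longrightarrow> A' = A"
proof (induction rule: hs_ty.induct)
  case (2 \<theta> A A' B B')
  then have "\<forall>i \<in> fv_ty B. lift_sbst \<theta> i = None" by (intro lift_sbst_None) auto
  with 2 show ?case by simp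
qed (simp add: hs_pty_fixes_unique)

lemma hs_ctx_closed_unique: "hs_ctx \<theta> G G' \<Longrightarrow> fv_ctx G = {} \<Longrightarrow> G' = G"
  by (induction rule: hs_ctx.induct) (auto dest: hs_ty_fixes_unique)

section \<open>Weakly well-formed formulas\<close>

text \<open>Substitution for context variables does not preserve \<open>wf_fm\<close>, since it may introduce closed
  types that are not arity-typed.\<close>

primrec weak_ctx :: "('n \<Rightarrow> arity) \<Rightarrow> ('c, 'n) sig \<Rightarrow> (nat \<rightharpoonup> arity) \<Rightarrow> ('c, 'n) ctx \<Rightarrow> bool" where
  "weak_ctx N S \<Psi> (CVar k) \<longleftrightarrow> True"
| "weak_ctx N S \<Psi> CEmp \<longleftrightarrow> True"
| "weak_ctx N S \<Psi> (CSnoc G n A) \<longleftrightarrow> weak_ctx N S \<Psi> G \<and> (ar_ty N S \<Psi> A \<or> fv_ty A = {})"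

text \<open>Only types bound in contexts are relaxed. Schemas stay well-formed, so that their
  instances remain typed.\<close>

primrec weak_fm :: "('n \<Rightarrow> arity) \<Rightarrow> ('c, 'n) sig \<Rightarrow> (nat \<rightharpoonup> arity) \<Rightarrow> ('c, 'n) fm \<Rightarrow> bool" where
  "weak_fm N S \<Psi> (FAtom G M A) \<longleftrightarrow>
     weak_ctx N S \<Psi> G \<and> ar_ty N S \<Psi> A \<and> ar_trm N S \<Psi> M (erase A)"
| "weak_fm N S \<Psi> FTop \<longleftrightarrow> True"
| "weak_fm N S \<Psi> FBot \<longleftrightarrow> True"
| "weak_fm N S \<Psi> (FImp F1 F2) \<longleftrightarrow> weak_fm N S \<Psi> F1 \<and> weak_fm N S \<Psi> F2"
| "weak_fm N S \<Psi> (FAnd F1 F2) \<longleftrightarrow> weak_fm N S \<Psi> F1 \<and> weak_fm N S \<Psi> F2"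
| "weak_fm N S \<Psi> (FOr F1 F2) \<longleftrightarrow> weak_fm N S \<Psi> F1 \<and> weak_fm N S \<Psi> F2"
| "weak_fm N S \<Psi> (FAll \<alpha> F) \<longleftrightarrow> weak_fm N S (ext \<alpha> \<Psi>) F"
| "weak_fm N S \<Psi> (FEx \<alpha> F) \<longleftrightarrow> weak_fm N S (ext \<alpha> \<Psi>) F"
| "weak_fm N S \<Psi> (FPi C F) \<longleftrightarrow> wf_schema N S C \<and> weak_fm N S \<Psi> F"

lemma wf_ctx_imp_weak: "wf_ctx N S \<Psi> X G \<Longrightarrow> weak_ctx N S \<Psi> G"
  by (induction G) auto

lemma wf_fm_imp_weak: "wf_fm N S \<Psi> X F \<Longrightarrow> weak_fm N S \<Psi> F"
  by (induction F arbitrary: \<Psi> X) (auto intro: wf_ctx_imp_weak)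

lemma closed_imp_weak: "fv_ctx G = {} \<Longrightarrow> weak_ctx N S \<Psi> G"
  by (induction G) auto

section \<open>Hereditary substitution into weakly well-formed formulas\<close>

lemma weak_ctx_hs:
  "hs_ctx \<theta> G G' \<Longrightarrow> weak_ctx N S \<Psi> G \<Longrightarrow> sbst_typed N S \<Psi> \<theta> \<Psi>' \<Longrightarrow> weak_ctx N S \<Psi>' G'"
  by (induction rule: hs_ctx.induct) (auto dest: ar_ty_hs hs_ty_fixes_unique)

lemma weak_fm_hs:
  "hs_fm \<theta> F F' \<Longrightarrow> weak_fm N S \<Psi> F \<Longrightarrow> sbst_typed N S \<Psi> \<theta> \<Psi>' \<Longrightarrow> weak_fm N S \<Psi>' F'"
  by (induction arbitrary: \<Psi> \<Psi>' rule: hs_fm.induct)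
    (auto simp: erase_hs intro: weak_ctx_hs ar_ty_hs ar_hs sbst_typed_lift)

lemma hs_ctx_total:
  "weak_ctx N S \<Psi> G \<Longrightarrow> sbst_typed N S \<Psi> \<theta> \<Psi>' \<Longrightarrow> arity_bounded k \<theta> \<Longrightarrow> \<exists>G'. hs_ctx \<theta> G G'"
proof (induction G)
  case (CSnoc G n A)
  \<comment> \<open>An arity-typed type has a result by totality, and a closed one is its own
    result.\<close>
  moreover from CSnoc.prems have "\<exists>A'. hs_ty \<theta> A A'"
    using hs_ty_total hs_ty_fixes by (metis emptyE weak_ctx.simps(3))
  ultimately show ?case by (auto intro: hs_ctx.intros)
qed (auto intro: hs_ctx.intros)

lemma hs_fm_total:
  "weak_fm N S \<Psi> F \<Longrightarrow> sbst_typed N S \<Psi> \<theta> \<Psi>' \<Longrightarrow> arity_bounded k \<theta> \<Longrightarrow> \<exists>F'. hs_fm \<theta> F F'"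
proof (induction F arbitrary: \<Psi> \<theta> \<Psi>')
  case (FAtom G M A)
  then show ?case
    by (meson hs_ctx_total hs_ty_total hs_trm_total hs_fm.intros(1) weak_fm.simps(1))
next
  case (FAll \<alpha> F)
  then show ?case
    by (meson hs_fm.intros(7) sbst_typed_lift arity_bounded_lift weak_fm.simps(7))
next
  case (FEx \<alpha> F)
  then show ?case
    by (meson hs_fm.intros(8) sbst_typed_lift arity_bounded_lift weak_fm.simps(8))
qed (auto intro: hs_fm.intros, (meson hs_fm.intros)+)

section \<open>Context substitution and schema instances\<close>

lemma weak_ctx_ren_shift: "weak_ctx N S \<Psi> G \<Longrightarrow> weak_ctx N S (ext \<alpha> \<Psi>) (ren_ctx shift G)"
  by (induction G) (auto simp: ren_ty_fixes intro: ar_ty_ren ren_typed_shift)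

lemma weak_ctx_cshift [simp]: "weak_ctx N S \<Psi> (cshift G) = weak_ctx N S \<Psi> G"
  by (induction G) auto

lemma weak_ctx_cs:
  "weak_ctx N S \<Psi> G \<Longrightarrow> \<forall>H \<in> ran \<sigma>. weak_ctx N S \<Psi> H \<Longrightarrow> weak_ctx N S \<Psi> (cs_ctx \<sigma> G)"
  by (induction G) (auto simp: ran_def split: option.splits)

lemma weak_fm_cs:
  "weak_fm N S \<Psi> F \<Longrightarrow> \<forall>H \<in> ran \<sigma>. weak_ctx N S \<Psi> H \<Longrightarrow> weak_fm N S \<Psi> (cs_fm \<sigma> F)"
proof (induction F arbitrary: \<Psi> \<sigma>)
  case (FAll \<alpha> F)
  then have "\<forall>H \<in> ran (shift_csbst \<sigma>). weak_ctx N S (ext \<alpha> \<Psi>) H"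
    by (auto simp: shift_csbst_def ran_def intro: weak_ctx_ren_shift)
  with FAll show ?case by auto
next
  case (FEx \<alpha> F)
  then have "\<forall>H \<in> ran (shift_csbst \<sigma>). weak_ctx N S (ext \<alpha> \<Psi>) H"
    by (auto simp: shift_csbst_def ran_def intro: weak_ctx_ren_shift)
  with FEx show ?case by auto
next
  case (FPi C F)
  then have "\<forall>H \<in> ran (lift_csbst \<sigma>). weak_ctx N S \<Psi> H"
    by (auto simp: lift_csbst_def ran_def split: nat.split_asm) blast
  with FPi show ?case by auto
qed (auto intro: weak_ctx_cs)

text \<open>The renaming respects arities because each \<open>ns\<close> entry has the erasure of
  its declared type. Replacing the header variables by the closed terms \<open>ts\<close> then
  removes the remaining variables.\<close>

lemma block_inst_typed:
  assumes "wf_block N S b" "block_inst N S b bs" "(n, A) \<in> set bs"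
  shows "ar_ty N S Map.empty A"
  using assms(2)
proof cases
  case (1 ts \<alpha>s ns As As')
  \<comment> \<open>The renaming used by \<open>block_inst\<close>: header variables keep their
    index, body variables become nominal constants.\<close>
  define f where "f = (\<lambda>i. case assign (map Inl [0..<length \<alpha>s] @ map Inr ns) i of
                          Some h \<Rightarrow> h | None \<Rightarrow> Inl i)"
  have len: "length ts = length \<alpha>s" "length ns = length As" "length As' = length As"
    using 1 by (auto dest: list_all2_lengthD map_eq_imp_length_eq)
  from assms(3) 1 obtain j where j: "j < length As" "A = As' ! j"
    by (metis in_set_conv_nth len(3) set_zip_rightD)
  have "ar_ty N S (assign (\<alpha>s @ map erase (take j As))) (As ! j)"
    using assms(1) 1 j by (auto simp: wf_block_def)
  moreover have "ren_typed N (assign (\<alpha>s @ map erase (take j As))) f (assign \<alpha>s)"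
    unfolding ren_typed_def
  proof (intro allI impI)
    fix i \<beta>
    assume i: "assign (\<alpha>s @ map erase (take j As)) i = Some \<beta>"
    show "case f i of Inl j \<Rightarrow> assign \<alpha>s j = Some \<beta> | Inr n \<Rightarrow> N n = \<beta>"
    proof (cases "i < length \<alpha>s")
      case True
      with i show ?thesis by (auto simp: f_def assign_def nth_append)
    next
      case False
      \<comment> \<open>The position of the variable within the block body; only declarations before
        position \<open>j\<close> are in scope.\<close>
      define l where "l = i - length \<alpha>s"
      from i False j have l: "l < j" "\<beta> = erase (As ! l)" "i = length \<alpha>s + l"
        by (auto simp: assign_def nth_append l_def split: if_splits)
      with j len have "N (ns ! l) = map erase As ! l"
        using 1(5) by (metis nth_map order_less_trans)
      with l j len show ?thesis by (simp add: f_def assign_def nth_append)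
    qed
  qed
  ultimately have "ar_ty N S (assign \<alpha>s) (ren_ty f (As ! j))"
    by (rule ar_ty_ren)
  moreover have "hs_ty (assign (zip ts \<alpha>s)) (ren_ty f (As ! j)) (As' ! j)"
    using 1(6) j by (auto simp: f_def list_all2_conv_all_nth)
  moreover have "sbst_typed N S (assign \<alpha>s) (assign (zip ts \<alpha>s)) Map.empty"
    using 1(3) len
    by (auto simp: sbst_typed_def assign_def list_all2_conv_all_nth split: if_splits)
  ultimately show ?thesis using j ar_ty_hs by blast
qed

lemma weak_ctx_foldl:
  "weak_ctx N S \<Psi> G \<Longrightarrow> \<forall>(n, A) \<in> set bs. ar_ty N S \<Psi> A \<Longrightarrow>
   weak_ctx N S \<Psi> (foldl (\<lambda>H (n, A). CSnoc H n A) G bs)"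
  by (induction bs arbitrary: G) auto

lemma weak_ctx_schema_inst:
  "schema_inst N S C G \<Longrightarrow> wf_schema N S C \<Longrightarrow> weak_ctx N S Map.empty G"
proof (induction rule: schema_inst.induct)
  case (2 G b bs)
  then show ?case
    by (intro weak_ctx_foldl) (auto simp: wf_schema_def dest: block_inst_typed)
qed simp

section \<open>The ill-formedness analysis under substitution\<close>

text \<open>The first argument is the initial segment: bindings are stripped from the second until
  it is reached.\<close>

primrec extends :: "('c, 'n) ctx \<Rightarrow> ('c, 'n) ctx \<Rightarrow> bool" where
  "extends G (CVar k) \<longleftrightarrow> G = CVar k"
| "extends G CEmp \<longleftrightarrow> G = CEmp"
| "extends G (CSnoc H n A) \<longleftrightarrow> G = CSnoc H n A \<or> extends G H"

lemma extends_refl [simp]: "extends G G"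
  by (cases G) auto

text \<open>The first disjunct turns into the second once \<open>CVar g\<close> is replaced by
  \<open>G\<close>.\<close>

definition stuck_ctx :: "('c, 'n) ctx \<Rightarrow> nat \<Rightarrow> ('c, 'n) ctx \<Rightarrow> bool" where
  "stuck_ctx G g H \<longleftrightarrow> g \<in> cvars H \<or> extends G H"

text \<open>The value \<open>True\<close> of the flag stands for the positive analysis. Replacing \<open>g\<close> by \<open>G\<close> does not
  leave the relation.\<close>

primrec ill :: "('c, 'n) ctx \<Rightarrow> nat \<Rightarrow> bool \<Rightarrow> ('c, 'n) fm \<Rightarrow> bool" where
  "ill G g p (FAtom H M A) \<longleftrightarrow> \<not> p \<and> stuck_ctx G g H"
| "ill G g p FTop \<longleftrightarrow> p"
| "ill G g p FBot \<longleftrightarrow> \<not> p"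
| "ill G g p (FImp F1 F2) \<longleftrightarrow>
     (if p then ill G g False F1 \<or> ill G g True F2 else ill G g True F1 \<and> ill G g False F2)"
| "ill G g p (FAnd F1 F2) \<longleftrightarrow>
     (if p then ill G g p F1 \<and> ill G g p F2 else ill G g p F1 \<or> ill G g p F2)"
| "ill G g p (FOr F1 F2) \<longleftrightarrow>
     (if p then ill G g p F1 \<or> ill G g p F2 else ill G g p F1 \<and> ill G g p F2)"
| "ill G g p (FAll \<alpha> F) \<longleftrightarrow> ill G g p F"
| "ill G g p (FEx \<alpha> F) \<longleftrightarrow> ill G g p F"
| "ill G g p (FPi C F) \<longleftrightarrow> ill G (Suc g) p F"

lemma ill_of_analysis:
  shows "ill_neg g F \<Longrightarrow> ill G g False F"
    and "ill_pos g F \<Longrightarrow> ill G g True F"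
  by (induction rule: ill_neg_ill_pos.inducts) (auto simp: stuck_ctx_def)

text \<open>Term substitution does not touch context variables, and it fixes the closed segment
  \<open>G\<close>.\<close>

lemma stuck_ctx_hs:
  assumes "hs_ctx \<theta> H H'" "closed_ctx G" "stuck_ctx G g H"
  shows "stuck_ctx G g H'"
proof -
  have fv: "fv_ctx G = {}" using assms(2) by (simp add: closed_ctx_def)
  have "cvars H' = cvars H" using assms(1) by induction auto
  moreover have "extends G H \<Longrightarrow> extends G H'"
    using assms(1)
  proof induction
    case (3 \<theta> H H' A A' n)
    show ?case
    proof (cases "G = CSnoc H n A")
      case True
      then have "CSnoc H' n A' = G"
        using hs_ctx_closed_unique[OF hs_ctx.intros(3)[OF 3(1,2)]] fv by blast
      then show ?thesis by simp
    next
      case False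
      with 3 show ?thesis by simp
    qed
  qed auto
  ultimately show ?thesis using assms(3) by (auto simp: stuck_ctx_def)
qed

lemma ill_hs:
  assumes "closed_ctx G"
  shows "hs_fm \<theta> F F' \<Longrightarrow> ill G g p F \<Longrightarrow> ill G g p F'"
  by (induction arbitrary: g p rule: hs_fm.induct)
    (auto split: if_splits intro: stuck_ctx_hs[OF _ assms])

text \<open>The two alternatives cover all uses: \<open>\<sigma>\<close> and schema instances leave
  \<open>g\<close> alone, the last substitution sends it to \<open>G\<close>.\<close>

lemma stuck_ctx_cs:
  assumes "closed_ctx G" "\<sigma> g = None \<or> \<sigma> g = Some G"
  shows "stuck_ctx G g H \<Longrightarrow> stuck_ctx G g (cs_ctx \<sigma> H)"
proof (induction H)
  case (CVar k)
  \<comment> \<open>Here \<open>k\<close> must be \<open>g\<close>, since a closed \<open>G\<close>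
    is not a context variable.\<close>
  then show ?case
    using assms by (auto simp: stuck_ctx_def closed_ctx_def)
next
  case (CSnoc H n A)
  have "cs_ctx \<sigma> G = G" using assms by (simp add: closed_ctx_def cs_ctx_closed)
  with CSnoc show ?case by (auto simp: stuck_ctx_def)
qed (auto simp: stuck_ctx_def)

text \<open>Binders shift the substituted contexts, but a closed \<open>G\<close> is unchanged by
  shifting, so the condition on \<open>\<sigma>\<close> passes under every quantifier.\<close>

lemma ill_cs:
  assumes "closed_ctx G"
  shows "\<sigma> g = None \<or> \<sigma> g = Some G \<Longrightarrow> ill G g p F \<Longrightarrow> ill G g p (cs_fm \<sigma> F)"
proof (induction F arbitrary: \<sigma> g p)
  case (FAtom H M A)
  then show ?case using stuck_ctx_cs assms by auto
next
  case (FAll \<alpha> F)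
  then have "shift_csbst \<sigma> g = None \<or> shift_csbst \<sigma> g = Some G"
    using assms by (auto simp: shift_csbst_def closed_ctx_def ren_ctx_closed)
  with FAll show ?case by simp
next
  case (FEx \<alpha> F)
  then have "shift_csbst \<sigma> g = None \<or> shift_csbst \<sigma> g = Some G"
    using assms by (auto simp: shift_csbst_def closed_ctx_def ren_ctx_closed)
  with FEx show ?case by simp
next
  case (FPi C F)
  then have "lift_csbst \<sigma> (Suc g) = None \<or> lift_csbst \<sigma> (Suc g) = Some G"
    using assms by (auto simp: lift_csbst_def closed_ctx_def cshift_closed)
  with FPi show ?case by simp
qed (auto split: if_splits)

section \<open>Validity\<close>

text \<open>No rule of \<open>lf_ctx\<close> accepts a context variable, and a derivation for a
  context contains one for each initial segment.\<close>

lemma lf_ctx_not_stuck: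
  "lf_ctx S H \<Longrightarrow> \<not> lf_ctx S G \<Longrightarrow> \<not> stuck_ctx G g H"
  by (induction rule: lf_ctx.induct) (auto simp: stuck_ctx_def intro: lf_ctx.intros)

lemma sbst_typed_closed_single:
  "ar_trm N S Map.empty M \<alpha> \<Longrightarrow> sbst_typed N S (ext \<alpha> Map.empty) [0 \<mapsto> (M, \<alpha>)] Map.empty"
  by (auto simp: sbst_typed_def ext_def split: nat.splits)

text \<open>The form \<open>valid N S F = p\<close> treats both polarities in one induction, as
  implication reads its antecedent at the opposite one.\<close>

lemma valid_if_ill:
  assumes N: "\<And>\<alpha>. infinite {n. N n = \<alpha>}"
    and G: "closed_ctx G" "\<not> lf_ctx S G"
  shows "weak_fm N S Map.empty F \<Longrightarrow> ill G g p F \<Longrightarrow> valid N S F = p"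
proof (induction "fm_height F" arbitrary: F g p rule: less_induct)
  case less
  \<comment> \<open>Shared by both term quantifiers: every instance is defined and has truth value
    \<open>p\<close>.\<close>
  have body: "(\<exists>F'. hs_fm [0 \<mapsto> (M, \<alpha>)] F0 F') \<and>
      (\<forall>F'. hs_fm [0 \<mapsto> (M, \<alpha>)] F0 F' \<longrightarrow> valid N S F' = p)"
    if M: "ar_trm N S Map.empty M \<alpha>" and F0: "weak_fm N S (ext \<alpha> Map.empty) F0" "ill G g p F0"
      and h: "fm_height F0 < fm_height F" for M \<alpha> F0
  proof (intro conjI allI impI)
    note \<theta> = sbst_typed_closed_single[OF M]
    have "arity_bounded (size \<alpha>) [0 \<mapsto> (M, \<alpha>)]" by (simp add: arity_bounded_def)
    then show "\<exists>F'. hs_fm [0 \<mapsto> (M, \<alpha>)] F0 F'" using hs_fm_total F0 \<theta> by blast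
    fix F' assume hs: "hs_fm [0 \<mapsto> (M, \<alpha>)] F0 F'"
    then show "valid N S F' = p"
      using less.hyps[of F'] h F0 \<theta> weak_fm_hs ill_hs[OF G(1)] fm_height_hs by metis
  qed
  show ?case
  proof (cases F)
    case (FAtom H M A)
    with less.prems G show ?thesis using lf_ctx_not_stuck by auto
  next
    case (FImp F1 F2)
    with less show ?thesis by (force split: if_splits)
  next
    case (FAnd F1 F2)
    with less show ?thesis by (force split: if_splits)
  next
    case (FOr F1 F2)
    with less show ?thesis by (force split: if_splits)
  next
    case (FAll \<alpha> F0)
    with less.prems have F0: "weak_fm N S (ext \<alpha> Map.empty) F0" "ill G g p F0"
        "fm_height F0 < fm_height F"
      by simp_all
    \<comment> \<open>For negative \<open>p\<close> this inhabitant gives the instance that refutes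
      the universal formula.\<close>
    obtain M0 where "ar_trm N S Map.empty M0 \<alpha>" using closed_term_exists[OF N] by blast
    then show ?thesis
      unfolding FAll valid.simps using body[OF _ F0] by (cases p) blast+
  next
    case (FEx \<alpha> F0)
    with less.prems have F0: "weak_fm N S (ext \<alpha> Map.empty) F0" "ill G g p F0"
        "fm_height F0 < fm_height F"
      by simp_all
    \<comment> \<open>For positive \<open>p\<close> this inhabitant is the witness.\<close>
    obtain M0 where "ar_trm N S Map.empty M0 \<alpha>" using closed_term_exists[OF N] by blast
    then show ?thesis
      unfolding FEx valid.simps using body[OF _ F0] by (cases p) blast+
  next
    case (FPi C F0)
    have "valid N S (cs_fm [0 \<mapsto> H] F0) = p" if H: "schema_inst N S C H" for H
    proof -
      have "weak_fm N S Map.empty (cs_fm [0 \<mapsto> H] F0)"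
        using less.prems FPi weak_ctx_schema_inst[OF H] by (auto intro: weak_fm_cs)
      \<comment> \<open>Replacing index \<open>0\<close> lowers no other index, so the instance
        still refers to \<open>g\<close> as \<open>Suc g\<close>; this is why \<open>g\<close> is
        generalized.\<close>
      moreover have "ill G (Suc g) p (cs_fm [0 \<mapsto> H] F0)"
        using less.prems FPi by (auto intro: ill_cs[OF G(1)])
      ultimately show ?thesis
        using less.hyps FPi by (simp add: fm_height_cs)
    qed
    \<comment> \<open>Zero blocks instantiate every schema, so for negative \<open>p\<close> some
      instance refutes the formula.\<close>
    moreover have "schema_inst N S C CEmp" by (rule schema_inst.intros)
    ultimately show ?thesis using FPi by auto
  qed (use less.prems in auto)
qed

theorem theorem5p1:
  fixes N :: "'n \<Rightarrow> arity"
    and S :: "('c, 'n) sig"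
    and F F\<theta> :: "('c, 'n) fm"
    and \<Psi> :: "nat \<rightharpoonup> arity"
    and \<Xi> :: "nat \<rightharpoonup> 'x"
    and \<theta> :: "('c, 'n) sbst"
    and \<Gamma> :: nat
    and \<sigma> :: "('c, 'n) csbst"
    and G :: "('c, 'n) ctx"
  assumes "\<And>\<alpha>. infinite {n. N n = \<alpha>}"
    and "wf_sig S"
    and "wf_fm N S \<Psi> (dom \<Xi>) F"
    and "closed_sbst N S \<Psi> \<theta>"
    and "hs_fm \<theta> F F\<theta>"
    and "closed_csbst (dom \<Xi> - {\<Gamma>}) \<sigma>"
    and "closed_ctx G"
    and "\<not> lf_ctx S G"
  shows "(ill_pos \<Gamma> F \<longrightarrow> valid N S (cs_fm [\<Gamma> \<mapsto> G] (cs_fm \<sigma> F\<theta>)))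
       \<and> (ill_neg \<Gamma> F \<longrightarrow> \<not> valid N S (cs_fm [\<Gamma> \<mapsto> G] (cs_fm \<sigma> F\<theta>)))"
proof -
  \<comment> \<open>A closed substitution covers all of \<open>\<Psi>\<close> by closed terms, so
    nothing remains assigned in the target.\<close>
  have "sbst_typed N S \<Psi> \<theta> Map.empty"
    using assms(4) unfolding closed_sbst_def sbst_typed_def
    by (fastforce split: option.splits)
  then have "weak_fm N S Map.empty F\<theta>"
    using weak_fm_hs[OF assms(5)] wf_fm_imp_weak[OF assms(3)] by blast
  moreover have "\<forall>H \<in> ran \<sigma>. weak_ctx N S Map.empty H"
    using assms(6) by (simp add: closed_csbst_def closed_ctx_def closed_imp_weak)
  ultimately have "weak_fm N S Map.empty (cs_fm \<sigma> F\<theta>)"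
    by (rule weak_fm_cs)
  moreover have "\<forall>H \<in> ran [\<Gamma> \<mapsto> G]. weak_ctx N S Map.empty H"
    using assms(7) by (simp add: closed_ctx_def closed_imp_weak)
  ultimately have weak: "weak_fm N S Map.empty (cs_fm [\<Gamma> \<mapsto> G] (cs_fm \<sigma> F\<theta>))"
    by (rule weak_fm_cs)
  \<comment> \<open>Thus \<open>\<sigma>\<close> leaves \<open>\<Gamma>\<close> in place for the
    final substitution, and both satisfy the condition of \<open>ill_cs\<close>.\<close>
  have "\<sigma> \<Gamma> = None"
    using assms(6) by (auto simp: closed_csbst_def dom_def)
  then have ill: "ill G \<Gamma> p (cs_fm [\<Gamma> \<mapsto> G] (cs_fm \<sigma> F\<theta>))" if "ill G \<Gamma> p F" for p
    using ill_cs[OF assms(7)] ill_hs[OF assms(7) assms(5) that] by simp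
  show ?thesis
    using valid_if_ill[OF assms(1,7,8) weak] ill ill_of_analysis by metis
qed

end
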